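(* Let $\alpha_{ij}$ ($1\le i,j\le3$), $\alpha_1,\alpha_2,\alpha_3$ be constants and let sequences $(a_x),(b_x),(c_x)$, $x\ge0$, satisfy for $x\ge1$ \[ \begin{aligned} a_x&=\alpha_{11}a_{x-1}+\alpha_{12}b_{x-1}+\alpha_{13}c_{x-1}+\alpha_1,\\ b_x&=\alpha_{21}a_{x-1}+\alpha_{22}b_{x-1}+\alpha_{23}c_{x-1}+\alpha_2,\\ c_x&=\alpha_{31}a_{x-1}+\alpha_{32}b_{x-1}+\alpha_{33}c_{x-1}+\alpha_3 . \end{aligned} \] Assume (1) $\alpha_{11}+\alpha_{12}+\alpha_{13}=\alpha_{31}+\alpha_{32}+\alpha_{33}$ and (2) there exist $w_1,w_2$ with $w_1+w_2=1$, $w_2\neq0$, such that $b_x=w_1a_x+w_2c_x$ for all $x$. Put $\alpha^*_{21}=w_1\alpha_{11}+w_2\alpha_{31}$, $\alpha^*_{23}=w_1\alpha_{13}+w_2\alpha_{33}$, $\alpha^*_2=w_1\alpha_1+w_2\alpha_3$, and $C_1=\alpha_{11}+\alpha_{12}+\alpha_{13}$, $C_2=\alpha_{12}+\frac1{w_2}\alpha_{13}$, $C_3=\alpha_{11}-\frac{w_1}{w_2}\alpha_{13}-\alpha^*_{21}+\frac{w_1}{w_2}\alpha^*_{23}$, $C_4=\alpha_{12}+\frac1{w_2}\alpha_{13}+\alpha^*_{21}-\frac{w_1}{w_2}\alpha^*_{23}$, $C_5=\alpha^*_{21}-\frac{w_1}{w_2}\alpha^*_{23}$. Then in all cases $c_x=-\frac{w_1}{w_2}a_x+\frac1{w_2}b_x$,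 and: 1. If $C_4\neq0$, $C_1\neq1$, $C_3\neq1$: \[ a_x=C_1^xa_0+C_2\frac{C_1^x-C_3^x}{C_4}(b_0-a_0)+\alpha_1\frac{C_1^x-1}{C_1-1}+\frac{(\alpha^*_2-\alpha_1)C_2}{C_4}\left(\frac{C_1^x-C_1}{C_1-1}-\frac{C_3^x-C_3}{C_3-1}\right), \] \[ b_x=C_1^xb_0+C_5\frac{C_1^x-C_3^x}{C_4}(a_0-b_0)+\alpha^*_2\frac{C_1^x-1}{C_1-1}+\frac{(\alpha_1-\alpha^*_2)C_5}{C_4}\left(\frac{C_1^x-C_1}{C_1-1}-\frac{C_3^x-C_3}{C_3-1}\right). \] 2. If $C_4\neq0$, $C_1=1$ (so $C_3\ne1$): \[ a_x=C_1^xa_0+C_2\frac{C_1^x-C_3^x}{C_4}(b_0-a_0)+\alpha_1x+\frac{(\alpha^*_2-\alpha_1)C_2}{C_3-1}\left(\frac{C_3^x-C_3}{C_3-1}-x+1\right), \] \[ b_x=C_1^xb_0+C_5\frac{C_1^x-C_3^x}{C_4}(a_0-b_0)+\alpha^*_2x+\frac{(\alpha_1-\alpha^*_2)C_5}{C_3-1}\left(\frac{C_3^x-C_3}{C_3-1}-x+1\right). \] 3. If $C_4\neq0$, $C_3=1$ (so $C_1\neq1$): \[ a_x=C_1^xa_0+C_2\frac{C_1^x-C_3^x}{C_4}(b_0-a_0)+\alpha_1\frac{C_1^x-1}{C_1-1}+\frac{(\alpha^*_2-\alpha_1)C_2}{C_1-1}\left(\frac{C_1^x-C_1}{C_1-1}-x+1\right),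 \] \[ b_x=C_1^xb_0+C_5\frac{C_1^x-C_3^x}{C_4}(a_0-b_0)+\alpha^*_2\frac{C_1^x-1}{C_1-1}+\frac{(\alpha_1-\alpha^*_2)C_5}{C_1-1}\left(\frac{C_1^x-C_1}{C_1-1}-x+1\right). \] 4. If $C_4=0$, $C_1\neq1$: \[ a_x=C_1^{x-1}\big(C_1a_0+C_2(b_0-a_0)x\big)+\alpha_1\frac{C_1^x-1}{C_1-1}+\frac{(\alpha^*_2-\alpha_1)C_2}{(C_1-1)^2}\big((x-1)C_1^x-xC_1^{x-1}+1\big), \] \[ b_x=C_1^{x-1}\big(C_1b_0+C_5(a_0-b_0)x\big)+\alpha^*_2\frac{C_1^x-1}{C_1-1}+\frac{(\alpha_1-\alpha^*_2)C_5}{(C_1-1)^2}\big((x-1)C_1^x-xC_1^{x-1}+1\big). \] 5. If $C_4=0$, $C_1=1$: \[ a_x=C_1^{x-1}\big(C_1a_0+C_2(b_0-a_0)x\big)+\alpha_1x+C_2(\alpha^*_2-\alpha_1)\frac{x(x-1)}2, \] \[ b_x=C_1^{x-1}\big(C_1b_0+C_5(a_0-b_0)x\big)+\alpha^*_2x+C_5(\alpha_1-\alpha^*_2)\frac{x(x-1)}2. \]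
   Context: $x$ is a nonnegative integer index and $a_0,b_0,c_0$ are the initial values; all other symbols are constants. *)

theory Defs
  imports Complex_Main
begin

end

(* In the variables (u, d) with u = a, d = b - a, or with u = b, d = a - b, the common row sum C1 makes
   the system triangular: d decouples with multiplier C3 = C1 - C4, and it drives u, whose multiplier is C1. *)
theory Submission
  imports Defs
begin

section \<open>Scalar affine recurrences\<close>

lemma affine_rec_solution:
  fixes d :: "nat \<Rightarrow> 'a :: field"
  assumes rec: "\<And>n. d (Suc n) = r * d n + t"
    and "r \<noteq> 1"
  shows "d n = r ^ n * d 0 + t * ((r ^ n - 1) / (r - 1))"
proof (induction n)
  case (Suc n)
  have "r - 1 \<noteq> 0" using \<open>r \<noteq> 1\<close> by simp
  then have "(r ^ Suc n - 1) / (r - 1) = r * ((r ^ n - 1) / (r - 1)) + 1"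
    by (simp add: divide_simps) (simp add: algebra_simps)
  then show ?case
    unfolding rec Suc by (simp add: algebra_simps)
qed simp

lemma affine_rec_solution_one:
  fixes d :: "nat \<Rightarrow> 'a :: comm_ring_1"
  assumes rec: "\<And>n. d (Suc n) = d n + t"
  shows "d n = d 0 + t * of_nat n"
  by (induction n) (simp_all add: rec algebra_simps)

section \<open>Triangular systems, split by coincidences among \<open>p\<close>, \<open>r\<close>
  and 1\<close>

text \<open>Once \<open>d\<close> is known in closed form, \<open>u\<close> solves a scalar
  recurrence with multiplier \<open>p\<close> and a known input, so its solution is a superposition
  of the responses to \<open>u 0\<close>, \<open>d 0\<close>, \<open>s\<close> and \<open>t\<close>.
  The factor of \<open>d 0\<close> comes from the convolution of the powers of \<open>p\<close> and
  \<open>r\<close>; for \<open>n\<close> at least 1 the last bracket is the sum of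
  \<open>p ^ k - r ^ k\<close> over \<open>k\<close> from 1 to \<open>n - 1\<close>.\<close>

lemma triangular_rec_generic:
  fixes u d :: "nat \<Rightarrow> 'a :: field"
  assumes rec_u: "\<And>n. u (Suc n) = p * u n + q * d n + s"
    and rec_d: "\<And>n. d (Suc n) = r * d n + t"
    and "p \<noteq> r" "p \<noteq> 1" "r \<noteq> 1"
  shows "u n = p ^ n * u 0 + q * ((p ^ n - r ^ n) / (p - r)) * d 0 + s * ((p ^ n - 1) / (p - 1))
    + t * q / (p - r) * ((p ^ n - p) / (p - 1) - (r ^ n - r) / (r - 1))"
proof (induction n)
  case 0
  \<comment> \<open>At index 0 both quotients in the last bracket equal -1, so they cancel.\<close>
  have "(1 - p) / (p - 1) = -1" "(1 - r) / (r - 1) = -1"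
    using assms by (simp_all add: divide_simps)
  then show ?case by simp
next
  case (Suc n)
  have nz: "p - r \<noteq> 0" "p - 1 \<noteq> 0" "r - 1 \<noteq> 0" using assms by simp_all
  \<comment> \<open>The three identities say that the coefficients of \<open>q * d 0\<close>,
    \<open>s\<close> and \<open>t * q\<close> each satisfy \<open>y (Suc n) = p * y n + f n\<close>,
    with input \<open>f n\<close> equal to \<open>r ^ n\<close>, 1 and
    \<open>(r ^ n - 1) / (r - 1)\<close> respectively.\<close>
  have 1: "(p ^ Suc n - r ^ Suc n) / (p - r) = p * ((p ^ n - r ^ n) / (p - r)) + r ^ n"
    using nz by (simp add: divide_simps) (simp add: algebra_simps)
  have 2: "(p ^ Suc n - 1) / (p - 1) = p * ((p ^ n - 1) / (p - 1)) + 1"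
    using nz by (simp add: divide_simps) (simp add: algebra_simps)
  have 3: "((p ^ Suc n - p) / (p - 1) - (r ^ Suc n - r) / (r - 1)) / (p - r)
    = p * (((p ^ n - p) / (p - 1) - (r ^ n - r) / (r - 1)) / (p - r)) + (r ^ n - 1) / (r - 1)"
    using nz by (simp add: divide_simps) (simp add: algebra_simps)
  have "u (Suc n) = p * u n + q * (r ^ n * d 0 + t * ((r ^ n - 1) / (r - 1))) + s"
    by (simp add: rec_u affine_rec_solution[of d r t n] rec_d \<open>r \<noteq> 1\<close>)
  also have "\<dots> = p ^ Suc n * u 0 + q * (p * ((p ^ n - r ^ n) / (p - r)) + r ^ n) * d 0
    + s * (p * ((p ^ n - 1) / (p - 1)) + 1)
    + t * q * (p * (((p ^ n - p) / (p - 1) - (r ^ n - r) / (r - 1)) / (p - r)) + (r ^ n - 1) / (r - 1))"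
    \<comment> \<open>With quotients written as products with inverses, only a ring rearrangement
      remains and no denominator has to be cleared.\<close>
    unfolding Suc by (simp add: divide_inverse algebra_simps)
  also have "\<dots> = p ^ Suc n * u 0 + q * ((p ^ Suc n - r ^ Suc n) / (p - r)) * d 0
    + s * ((p ^ Suc n - 1) / (p - 1))
    + t * q / (p - r) * ((p ^ Suc n - p) / (p - 1) - (r ^ Suc n - r) / (r - 1))"
    unfolding 1[symmetric] 2[symmetric] 3[symmetric] by simp
  finally show ?case .
qed

text \<open>With multiplier 1 the sequence \<open>u\<close> just accumulates its input, so
  \<open>s\<close> contributes linearly and \<open>t * q\<close> contributes the sum of
  \<open>(r ^ k - 1) / (r - 1)\<close> over \<open>k < n\<close>. The last bracket is
  \<open>(r ^ n - 1) / (r - 1) - of_nat n\<close> in the shape used by the theorem.\<close>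

lemma triangular_rec_p_one:
  fixes u d :: "nat \<Rightarrow> 'a :: field"
  assumes rec_u: "\<And>n. u (Suc n) = u n + q * d n + s"
    and rec_d: "\<And>n. d (Suc n) = r * d n + t"
    and "r \<noteq> 1"
  shows "u n = u 0 + q * ((1 - r ^ n) / (1 - r)) * d 0 + s * of_nat n
    + t * q / (r - 1) * ((r ^ n - r) / (r - 1) - of_nat n + 1)"
proof (induction n)
  case 0
  have "(1 - r) / (r - 1) = -1"
    using assms by (simp add: divide_simps)
  then show ?case by simp
next
  case (Suc n)
  have nz: "1 - r \<noteq> 0" "r - 1 \<noteq> 0" using assms by simp_all
  have 1: "(1 - r ^ Suc n) / (1 - r) = (1 - r ^ n) / (1 - r) + r ^ n"
    using nz by (simp add: divide_simps) (simp add: algebra_simps)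
  have 2: "((r ^ Suc n - r) / (r - 1) - of_nat (Suc n) + 1) / (r - 1)
    = ((r ^ n - r) / (r - 1) - of_nat n + 1) / (r - 1) + (r ^ n - 1) / (r - 1)"
    using nz by (simp add: divide_simps) (simp add: algebra_simps)
  have "u (Suc n) = u n + q * (r ^ n * d 0 + t * ((r ^ n - 1) / (r - 1))) + s"
    by (simp add: rec_u affine_rec_solution[of d r t n] rec_d \<open>r \<noteq> 1\<close>)
  also have "\<dots> = u 0 + q * ((1 - r ^ n) / (1 - r) + r ^ n) * d 0 + s * of_nat (Suc n)
    + t * q * (((r ^ n - r) / (r - 1) - of_nat n + 1) / (r - 1) + (r ^ n - 1) / (r - 1))"
    unfolding Suc by (simp add: divide_inverse algebra_simps)
  also have "\<dots> = u 0 + q * ((1 - r ^ Suc n) / (1 - r)) * d 0 + s * of_nat (Suc n)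
    + t * q / (r - 1) * ((r ^ Suc n - r) / (r - 1) - of_nat (Suc n) + 1)"
    unfolding 1[symmetric] 2[symmetric] by simp
  finally show ?case .
qed

text \<open>Here \<open>d\<close> is linear in the index. Its constant part \<open>d 0\<close> acts
  on \<open>u\<close> exactly as \<open>s\<close> does, which is why both have the same geometric
  factor; the linear part gives the last term.\<close>

lemma triangular_rec_r_one:
  fixes u d :: "nat \<Rightarrow> 'a :: field"
  assumes rec_u: "\<And>n. u (Suc n) = p * u n + q * d n + s"
    and rec_d: "\<And>n. d (Suc n) = d n + t"
    and "p \<noteq> 1"
  shows "u n = p ^ n * u 0 + q * ((p ^ n - 1) / (p - 1)) * d 0 + s * ((p ^ n - 1) / (p - 1))
    + t * q / (p - 1) * ((p ^ n - p) / (p - 1) - of_nat n + 1)"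
proof (induction n)
  case 0
  have "(1 - p) / (p - 1) = -1"
    using assms by (simp add: divide_simps)
  then show ?case by simp
next
  case (Suc n)
  have nz: "p - 1 \<noteq> 0" using assms by simp
  have 1: "(p ^ Suc n - 1) / (p - 1) = p * ((p ^ n - 1) / (p - 1)) + 1"
    using nz by (simp add: divide_simps) (simp add: algebra_simps)
  \<comment> \<open>The coefficient of \<open>t * q\<close> is the response to the input
    \<open>of_nat n\<close>.\<close>
  have 2: "((p ^ Suc n - p) / (p - 1) - of_nat (Suc n) + 1) / (p - 1)
    = p * (((p ^ n - p) / (p - 1) - of_nat n + 1) / (p - 1)) + of_nat n"
    using nz by (simp add: divide_simps) (simp add: algebra_simps)
  have "u (Suc n) = p * u n + q * (d 0 + t * of_nat n) + s"
    by (simp add: rec_u affine_rec_solution_one[of d t n] rec_d)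
  also have "\<dots> = p ^ Suc n * u 0 + q * (p * ((p ^ n - 1) / (p - 1)) + 1) * d 0
    + s * (p * ((p ^ n - 1) / (p - 1)) + 1)
    + t * q * (p * (((p ^ n - p) / (p - 1) - of_nat n + 1) / (p - 1)) + of_nat n)"
    unfolding Suc by (simp add: divide_inverse algebra_simps)
  also have "\<dots> = p ^ Suc n * u 0 + q * ((p ^ Suc n - 1) / (p - 1)) * d 0
    + s * ((p ^ Suc n - 1) / (p - 1))
    + t * q / (p - 1) * ((p ^ Suc n - p) / (p - 1) - of_nat (Suc n) + 1)"
    unfolding 1[symmetric] 2[symmetric] by simp
  finally show ?case .
qed

text \<open>Resonance: the input contains \<open>p ^ n\<close> itself, which produces the factor
  index times power. The coefficient of \<open>t * q\<close> is the derivative with respect to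
  \<open>p\<close> of the geometric sum \<open>(p ^ m - 1) / (p - 1)\<close> at
  \<open>m = Suc n\<close>. The shift to \<open>Suc n\<close> keeps all exponents natural, so
  \<open>p = 0\<close> is covered.\<close>

lemma triangular_rec_double_Suc:
  fixes u d :: "nat \<Rightarrow> 'a :: field"
  assumes rec_u: "\<And>n. u (Suc n) = p * u n + q * d n + s"
    and rec_d: "\<And>n. d (Suc n) = p * d n + t"
    and "p \<noteq> 1"
  shows "u (Suc n) = p ^ n * (p * u 0 + q * d 0 * of_nat (Suc n)) + s * ((p ^ Suc n - 1) / (p - 1))
    + t * q / (p - 1) ^ 2 * (of_nat n * p ^ Suc n - of_nat (Suc n) * p ^ n + 1)"
proof (induction n)
  case 0
  show ?case using \<open>p \<noteq> 1\<close> by (simp add: rec_u)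
next
  case (Suc n)
  have nz: "p - 1 \<noteq> 0" using assms by simp
  have 1: "(p ^ Suc (Suc n) - 1) / (p - 1) = p * ((p ^ Suc n - 1) / (p - 1)) + 1"
    using nz by (simp add: divide_simps) (simp add: algebra_simps)
  have 2: "(of_nat (Suc n) * p ^ Suc (Suc n) - of_nat (Suc (Suc n)) * p ^ Suc n + 1) / (p - 1) ^ 2
    = p * ((of_nat n * p ^ Suc n - of_nat (Suc n) * p ^ n + 1) / (p - 1) ^ 2)
      + (p ^ Suc n - 1) / (p - 1)"
    using nz by (simp add: divide_simps) (simp add: algebra_simps power2_eq_square)
  have "u (Suc (Suc n)) = p * u (Suc n) + q * (p ^ Suc n * d 0 + t * ((p ^ Suc n - 1) / (p - 1))) + s"
    using affine_rec_solution[of d p t "Suc n"] rec_d \<open>p \<noteq> 1\<close> by (simp add: rec_u)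
  also have "\<dots> = p ^ Suc n * (p * u 0 + q * d 0 * of_nat (Suc (Suc n)))
    + s * (p * ((p ^ Suc n - 1) / (p - 1)) + 1)
    + t * q * (p * ((of_nat n * p ^ Suc n - of_nat (Suc n) * p ^ n + 1) / (p - 1) ^ 2)
      + (p ^ Suc n - 1) / (p - 1))"
    unfolding Suc by (simp add: divide_inverse algebra_simps)
  also have "\<dots> = p ^ Suc n * (p * u 0 + q * d 0 * of_nat (Suc (Suc n)))
    + s * ((p ^ Suc (Suc n) - 1) / (p - 1))
    + t * q / (p - 1) ^ 2
      * (of_nat (Suc n) * p ^ Suc (Suc n) - of_nat (Suc (Suc n)) * p ^ Suc n + 1)"
    unfolding 1[symmetric] 2[symmetric] by simp
  finally show ?case .
qed

text \<open>The integer exponent extends the shifted formula to index 0. The last hypothesis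
  excludes only \<open>n = 0\<close> with \<open>p = 0\<close>: there \<open>0 powi (-1)\<close> is
  0 by convention, so the right-hand side would be 0 instead of \<open>u 0\<close>.\<close>

lemma triangular_rec_double:
  fixes u d :: "nat \<Rightarrow> 'a :: field"
  assumes rec_u: "\<And>n. u (Suc n) = p * u n + q * d n + s"
    and rec_d: "\<And>n. d (Suc n) = p * d n + t"
    and "p \<noteq> 1"
    and "n \<ge> 1 \<or> p \<noteq> 0"
  shows "u n = p powi (int n - 1) * (p * u 0 + q * d 0 * of_nat n) + s * ((p ^ n - 1) / (p - 1))
    + t * q / (p - 1) ^ 2 * ((of_nat n - 1) * p ^ n - of_nat n * p powi (int n - 1) + 1)"
proof (cases n)
  case 0
  with \<open>n \<ge> 1 \<or> p \<noteq> 0\<close> show ?thesis by (simp add: power_int_minus)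
next
  case (Suc m)
  then have "p powi (int n - 1) = p ^ m" by simp
  then show ?thesis
    using triangular_rec_double_Suc[of u p q d s t m] assms Suc by simp
qed

text \<open>Two successive summations: \<open>d\<close> is linear, hence \<open>u\<close> is
  quadratic, with \<open>of_nat n * (of_nat n - 1) / 2\<close> as the sum of the indices below
  \<open>n\<close>. Characteristic 0 makes the division by 2 legitimate.\<close>

lemma triangular_rec_all_one:
  fixes u d :: "nat \<Rightarrow> 'a :: field_char_0"
  assumes rec_u: "\<And>n. u (Suc n) = u n + q * d n + s"
    and rec_d: "\<And>n. d (Suc n) = d n + t"
  shows "u n = u 0 + q * d 0 * of_nat n + s * of_nat n
    + q * t * (of_nat n * (of_nat n - 1) / 2)"
proof (induction n)
  case (Suc n)
  have "u (Suc n) = u n + q * (d 0 + t * of_nat n) + s"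
    by (simp add: rec_u affine_rec_solution_one[of d t n] rec_d)
  then show ?case
    unfolding Suc by (simp add: field_simps)
qed simp

section \<open>Reduction of the three sequences to triangular systems\<close>

theorem theorem2:
  fixes \<alpha>11 \<alpha>12 \<alpha>13 \<alpha>21 \<alpha>22 \<alpha>23 \<alpha>31 \<alpha>32 \<alpha>33 \<alpha>1 \<alpha>2 \<alpha>3 w1 w2 :: "'a :: field_char_0"
    and \<alpha>s21 \<alpha>s23 \<alpha>s2 C1 C2 C3 C4 C5 :: "'a"
    and a b c :: "nat \<Rightarrow> 'a"
  assumes rec_a: "\<forall>x\<ge>1. a x = \<alpha>11 * a (x - 1) + \<alpha>12 * b (x - 1) + \<alpha>13 * c (x - 1) + \<alpha>1"
    and rec_b: "\<forall>x\<ge>1. b x = \<alpha>21 * a (x - 1) + \<alpha>22 * b (x - 1) + \<alpha>23 * c (x - 1) + \<alpha>2"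
    and rec_c: "\<forall>x\<ge>1. c x = \<alpha>31 * a (x - 1) + \<alpha>32 * b (x - 1) + \<alpha>33 * c (x - 1) + \<alpha>3"
    and row_sums: "\<alpha>11 + \<alpha>12 + \<alpha>13 = \<alpha>31 + \<alpha>32 + \<alpha>33"
    and w_sum: "w1 + w2 = 1"
    and w2_nonzero: "w2 \<noteq> 0"
    and b_comb: "\<forall>x. b x = w1 * a x + w2 * c x"
    and \<alpha>s21_eq: "\<alpha>s21 = w1 * \<alpha>11 + w2 * \<alpha>31"
    and \<alpha>s23_eq: "\<alpha>s23 = w1 * \<alpha>13 + w2 * \<alpha>33"
    and \<alpha>s2_eq: "\<alpha>s2 = w1 * \<alpha>1 + w2 * \<alpha>3"
    and C1_eq: "C1 = \<alpha>11 + \<alpha>12 + \<alpha>13"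
    and C2_eq: "C2 = \<alpha>12 + 1 / w2 * \<alpha>13"
    and C3_eq: "C3 = \<alpha>11 - w1 / w2 * \<alpha>13 - \<alpha>s21 + w1 / w2 * \<alpha>s23"
    and C4_eq: "C4 = \<alpha>12 + 1 / w2 * \<alpha>13 + \<alpha>s21 - w1 / w2 * \<alpha>s23"
    and C5_eq: "C5 = \<alpha>s21 - w1 / w2 * \<alpha>s23"
  shows
    "(\<forall>x. c x = - (w1 / w2) * a x + 1 / w2 * b x)
     \<and> (C4 \<noteq> 0 \<and> C1 \<noteq> 1 \<and> C3 \<noteq> 1 \<longrightarrow>
          (\<forall>x. a x = C1 ^ x * a 0 + C2 * ((C1 ^ x - C3 ^ x) / C4) * (b 0 - a 0)
                  + \<alpha>1 * ((C1 ^ x - 1) / (C1 - 1))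
                  + (\<alpha>s2 - \<alpha>1) * C2 / C4
                    * ((C1 ^ x - C1) / (C1 - 1) - (C3 ^ x - C3) / (C3 - 1))
             \<and> b x = C1 ^ x * b 0 + C5 * ((C1 ^ x - C3 ^ x) / C4) * (a 0 - b 0)
                  + \<alpha>s2 * ((C1 ^ x - 1) / (C1 - 1))
                  + (\<alpha>1 - \<alpha>s2) * C5 / C4
                    * ((C1 ^ x - C1) / (C1 - 1) - (C3 ^ x - C3) / (C3 - 1))))
     \<and> (C4 \<noteq> 0 \<and> C1 = 1 \<longrightarrow>
          C3 \<noteq> 1 \<and>
          (\<forall>x. a x = C1 ^ x * a 0 + C2 * ((C1 ^ x - C3 ^ x) / C4) * (b 0 - a 0)
                  + \<alpha>1 * of_nat x
                  + (\<alpha>s2 - \<alpha>1) * C2 / (C3 - 1) * ((C3 ^ x - C3) / (C3 - 1) - of_nat x + 1)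
             \<and> b x = C1 ^ x * b 0 + C5 * ((C1 ^ x - C3 ^ x) / C4) * (a 0 - b 0)
                  + \<alpha>s2 * of_nat x
                  + (\<alpha>1 - \<alpha>s2) * C5 / (C3 - 1) * ((C3 ^ x - C3) / (C3 - 1) - of_nat x + 1)))
     \<and> (C4 \<noteq> 0 \<and> C3 = 1 \<longrightarrow>
          C1 \<noteq> 1 \<and>
          (\<forall>x. a x = C1 ^ x * a 0 + C2 * ((C1 ^ x - C3 ^ x) / C4) * (b 0 - a 0)
                  + \<alpha>1 * ((C1 ^ x - 1) / (C1 - 1))
                  + (\<alpha>s2 - \<alpha>1) * C2 / (C1 - 1) * ((C1 ^ x - C1) / (C1 - 1) - of_nat x + 1)
             \<and> b x = C1 ^ x * b 0 + C5 * ((C1 ^ x - C3 ^ x) / C4) * (a 0 - b 0)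
                  + \<alpha>s2 * ((C1 ^ x - 1) / (C1 - 1))
                  + (\<alpha>1 - \<alpha>s2) * C5 / (C1 - 1) * ((C1 ^ x - C1) / (C1 - 1) - of_nat x + 1)))
     \<and> (C4 = 0 \<and> C1 \<noteq> 1 \<longrightarrow>
          (\<forall>x. x \<ge> 1 \<or> C1 \<noteq> 0 \<longrightarrow>
             a x = C1 powi (int x - 1) * (C1 * a 0 + C2 * (b 0 - a 0) * of_nat x)
                  + \<alpha>1 * ((C1 ^ x - 1) / (C1 - 1))
                  + (\<alpha>s2 - \<alpha>1) * C2 / (C1 - 1) ^ 2
                    * ((of_nat x - 1) * C1 ^ x - of_nat x * C1 powi (int x - 1) + 1)
             \<and> b x = C1 powi (int x - 1) * (C1 * b 0 + C5 * (a 0 - b 0) * of_nat x)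
                  + \<alpha>s2 * ((C1 ^ x - 1) / (C1 - 1))
                  + (\<alpha>1 - \<alpha>s2) * C5 / (C1 - 1) ^ 2
                    * ((of_nat x - 1) * C1 ^ x - of_nat x * C1 powi (int x - 1) + 1)))
     \<and> (C4 = 0 \<and> C1 = 1 \<longrightarrow>
          (\<forall>x. a x = C1 powi (int x - 1) * (C1 * a 0 + C2 * (b 0 - a 0) * of_nat x)
                  + \<alpha>1 * of_nat x
                  + C2 * (\<alpha>s2 - \<alpha>1) * (of_nat x * (of_nat x - 1) / 2)
             \<and> b x = C1 powi (int x - 1) * (C1 * b 0 + C5 * (a 0 - b 0) * of_nat x)
                  + \<alpha>s2 * of_nat x
                  + C5 * (\<alpha>1 - \<alpha>s2) * (of_nat x * (of_nat x - 1) / 2)))"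
proof -
  have c_eq: "c x = - (w1 / w2) * a x + 1 / w2 * b x" for x
    using b_comb w2_nonzero by (simp add: field_simps)
  have C3_alt: "C3 = C1 - C4"
  proof -
    \<comment> \<open>The discrepancy is a multiple of \<open>1 - w1 - w2\<close>, which vanishes
      because the weights sum to 1.\<close>
    have "C3 - (C1 - C4) = \<alpha>13 * ((1 - w1 - w2) / w2)"
      unfolding C1_eq C3_eq C4_eq using w2_nonzero by (simp add: field_simps)
    then show ?thesis using w_sum by (simp add: algebra_simps)
  qed
  have C25: "C2 + C5 = C4"
    unfolding C2_eq C4_eq C5_eq by simp
  have w1: "w1 = 1 - w2" using w_sum by (simp add: eq_diff_eq)
  have step_a: "a (Suc n) = C1 * a n + C2 * (b n - a n) + \<alpha>1" for n
  proof -
    have "a (Suc n) = \<alpha>11 * a n + \<alpha>12 * b n + \<alpha>13 * c n + \<alpha>1" using rec_a by simp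
    then show ?thesis
      \<comment> \<open>After elimination of \<open>c\<close> the coefficient of \<open>b n\<close>
        is \<open>C2\<close>, and since \<open>(1 - w1) / w2 = 1\<close> the coefficients of
        \<open>a n\<close> and \<open>b n\<close> still sum to \<open>C1\<close>.\<close>
      unfolding c_eq C1_eq C2_eq w1 using w2_nonzero by (simp add: field_simps)
  qed
  have step_c: "c (Suc n) = \<alpha>31 * a n + \<alpha>32 * b n + \<alpha>33 * c n + \<alpha>3" for n
    using rec_c by simp
  have \<alpha>32: "\<alpha>32 = C1 - \<alpha>31 - \<alpha>33"
    using row_sums C1_eq by (simp add: algebra_simps)
  have \<alpha>12: "\<alpha>12 = C1 - \<alpha>11 - \<alpha>13"
    using C1_eq by (simp add: algebra_simps)
  have step_b: "b (Suc n) = C1 * b n + C5 * (a n - b n) + \<alpha>s2" for n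
  proof -
    \<comment> \<open>Weighting the recurrences of \<open>a\<close> and \<open>c\<close> produces
      the starred constants. Both rows sum to \<open>C1\<close>, hence so does their combination;
      eliminating \<open>c\<close> leaves \<open>C5\<close> on \<open>a n\<close> and
      \<open>C1 - C5\<close> on \<open>b n\<close>.\<close>
    have "b (Suc n) = w1 * (\<alpha>11 * a n + \<alpha>12 * b n + \<alpha>13 * c n + \<alpha>1)
        + w2 * (\<alpha>31 * a n + \<alpha>32 * b n + \<alpha>33 * c n + \<alpha>3)"
      using b_comb rec_a step_c by simp
    then show ?thesis
      unfolding c_eq C5_eq \<alpha>s21_eq \<alpha>s23_eq \<alpha>s2_eq \<alpha>12 \<alpha>32 w1
      using w2_nonzero by (simp add: divide_simps) (simp add: algebra_simps)
  qed
  \<comment> \<open>Subtraction gives the multiplier \<open>C1 - (C2 + C5)\<close>, which is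
    \<open>C1 - C4 = C3\<close>.\<close>
  have step_ba: "b (Suc n) - a (Suc n) = C3 * (b n - a n) + (\<alpha>s2 - \<alpha>1)" for n
    unfolding step_a step_b C3_alt C25[symmetric] by (simp add: algebra_simps)
  have step_ab: "a (Suc n) - b (Suc n) = C3 * (a n - b n) + (\<alpha>1 - \<alpha>s2)" for n
    unfolding step_a step_b C3_alt C25[symmetric] by (simp add: algebra_simps)
  have diff: "C1 - C3 = C4" by (simp add: C3_alt)
  note gen = triangular_rec_generic[where p = C1 and r = C3, unfolded diff]
    and p_one = triangular_rec_p_one[where r = C3]
    and r_one = triangular_rec_r_one[where p = C1]
    and double = triangular_rec_double[where p = C1]
    and all_one = triangular_rec_all_one
  show ?thesis
  proof (intro conjI impI allI)
    fix x :: nat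
    show "c x = - (w1 / w2) * a x + 1 / w2 * b x" by (rule c_eq)
  next
    fix x :: nat
    assume H: "C4 \<noteq> 0 \<and> C1 \<noteq> 1 \<and> C3 \<noteq> 1"
    then have "C1 \<noteq> C3" using diff by auto
    with H show "a x = C1 ^ x * a 0 + C2 * ((C1 ^ x - C3 ^ x) / C4) * (b 0 - a 0)
                  + \<alpha>1 * ((C1 ^ x - 1) / (C1 - 1))
                  + (\<alpha>s2 - \<alpha>1) * C2 / C4
                    * ((C1 ^ x - C1) / (C1 - 1) - (C3 ^ x - C3) / (C3 - 1))"
      and "b x = C1 ^ x * b 0 + C5 * ((C1 ^ x - C3 ^ x) / C4) * (a 0 - b 0)
                  + \<alpha>s2 * ((C1 ^ x - 1) / (C1 - 1))
                  + (\<alpha>1 - \<alpha>s2) * C5 / C4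
                    * ((C1 ^ x - C1) / (C1 - 1) - (C3 ^ x - C3) / (C3 - 1))"
      using gen[of a C2 "\<lambda>n. b n - a n" \<alpha>1 "\<alpha>s2 - \<alpha>1" x, OF step_a step_ba]
        gen[of b C5 "\<lambda>n. a n - b n" \<alpha>s2 "\<alpha>1 - \<alpha>s2" x, OF step_b step_ab]
      by blast+
  next
    assume H: "C4 \<noteq> 0 \<and> C1 = 1"
    then show r: "C3 \<noteq> 1" using diff by auto
    \<comment> \<open>The second equation turns the denominator \<open>1 - C3\<close> of the factor
      of \<open>d 0\<close> into the \<open>C4\<close> of the claim.\<close>
    have 1: "C1 = 1" "1 - C3 = C4" using H diff by auto
    fix x :: nat
    show "a x = C1 ^ x * a 0 + C2 * ((C1 ^ x - C3 ^ x) / C4) * (b 0 - a 0)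
                  + \<alpha>1 * of_nat x
                  + (\<alpha>s2 - \<alpha>1) * C2 / (C3 - 1) * ((C3 ^ x - C3) / (C3 - 1) - of_nat x + 1)"
      using p_one[of a C2 "\<lambda>n. b n - a n" \<alpha>1 "\<alpha>s2 - \<alpha>1" x] step_a step_ba r by (simp add: 1)
    show "b x = C1 ^ x * b 0 + C5 * ((C1 ^ x - C3 ^ x) / C4) * (a 0 - b 0)
                  + \<alpha>s2 * of_nat x
                  + (\<alpha>1 - \<alpha>s2) * C5 / (C3 - 1) * ((C3 ^ x - C3) / (C3 - 1) - of_nat x + 1)"
      using p_one[of b C5 "\<lambda>n. a n - b n" \<alpha>s2 "\<alpha>1 - \<alpha>s2" x] step_b step_ab r by (simp add: 1)
  next
    assume H: "C4 \<noteq> 0 \<and> C3 = 1"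
    then show p: "C1 \<noteq> 1" using diff by auto
    \<comment> \<open>Here \<open>C4\<close> is replaced instead, so that
      \<open>(C1 ^ x - C3 ^ x) / C4\<close> becomes the geometric factor.\<close>
    have 1: "C3 = 1" "C4 = C1 - 1" using H diff by auto
    fix x :: nat
    show "a x = C1 ^ x * a 0 + C2 * ((C1 ^ x - C3 ^ x) / C4) * (b 0 - a 0)
                  + \<alpha>1 * ((C1 ^ x - 1) / (C1 - 1))
                  + (\<alpha>s2 - \<alpha>1) * C2 / (C1 - 1) * ((C1 ^ x - C1) / (C1 - 1) - of_nat x + 1)"
      using r_one[of a C2 "\<lambda>n. b n - a n" \<alpha>1 "\<alpha>s2 - \<alpha>1" x] step_a step_ba p by (simp add: 1)
    show "b x = C1 ^ x * b 0 + C5 * ((C1 ^ x - C3 ^ x) / C4) * (a 0 - b 0)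
                  + \<alpha>s2 * ((C1 ^ x - 1) / (C1 - 1))
                  + (\<alpha>1 - \<alpha>s2) * C5 / (C1 - 1) * ((C1 ^ x - C1) / (C1 - 1) - of_nat x + 1)"
      using r_one[of b C5 "\<lambda>n. a n - b n" \<alpha>s2 "\<alpha>1 - \<alpha>s2" x] step_b step_ab p by (simp add: 1)
  next
    fix x :: nat
    assume H: "C4 = 0 \<and> C1 \<noteq> 1" "x \<ge> 1 \<or> C1 \<noteq> 0"
    \<comment> \<open>Vanishing of \<open>C4\<close> means that the two multipliers coincide, which
      is the resonant case.\<close>
    then have "C3 = C1" using diff by simp
    with H show "a x = C1 powi (int x - 1) * (C1 * a 0 + C2 * (b 0 - a 0) * of_nat x)
                  + \<alpha>1 * ((C1 ^ x - 1) / (C1 - 1))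
                  + (\<alpha>s2 - \<alpha>1) * C2 / (C1 - 1) ^ 2
                    * ((of_nat x - 1) * C1 ^ x - of_nat x * C1 powi (int x - 1) + 1)"
      and "b x = C1 powi (int x - 1) * (C1 * b 0 + C5 * (a 0 - b 0) * of_nat x)
                  + \<alpha>s2 * ((C1 ^ x - 1) / (C1 - 1))
                  + (\<alpha>1 - \<alpha>s2) * C5 / (C1 - 1) ^ 2
                    * ((of_nat x - 1) * C1 ^ x - of_nat x * C1 powi (int x - 1) + 1)"
      using double[of a C2 "\<lambda>n. b n - a n" \<alpha>1 "\<alpha>s2 - \<alpha>1" x, OF step_a]
        double[of b C5 "\<lambda>n. a n - b n" \<alpha>s2 "\<alpha>1 - \<alpha>s2" x, OF step_b] step_ba step_ab
      by blast+
  next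
    fix x :: nat
    assume H: "C4 = 0 \<and> C1 = 1"
    \<comment> \<open>All integer powers of \<open>C1\<close> are now 1, including exponent -1 at
      \<open>x = 0\<close>, so index 0 needs no guard.\<close>
    then have 1: "C3 = 1" "C1 = 1" using diff by simp_all
    show "a x = C1 powi (int x - 1) * (C1 * a 0 + C2 * (b 0 - a 0) * of_nat x)
                  + \<alpha>1 * of_nat x
                  + C2 * (\<alpha>s2 - \<alpha>1) * (of_nat x * (of_nat x - 1) / 2)"
      using all_one[of a C2 "\<lambda>n. b n - a n" \<alpha>1 "\<alpha>s2 - \<alpha>1" x] step_a step_ba by (simp add: 1)
    show "b x = C1 powi (int x - 1) * (C1 * b 0 + C5 * (a 0 - b 0) * of_nat x)
                  + \<alpha>s2 * of_nat x
                  + C5 * (\<alpha>1 - \<alpha>s2) * (of_nat x * (of_nat x - 1) / 2)"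
      using all_one[of b C5 "\<lambda>n. a n - b n" \<alpha>s2 "\<alpha>1 - \<alpha>s2" x] step_b step_ab by (simp add: 1)
  qed
qed

end
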